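(* There exist minimal equicontinuous actions of discrete finitely generated groups on a Cantor set $X$ which are not locally quasi-analytic (LQA) and such that the groups do not contain non-Hausdorff elements. That is, non-LQA minimal equicontinuous actions of discrete groups on Cantor sets with non-Hausdorff elements, and those without non-Hausdorff elements, form two distinct non-empty classes.
   Context: A Cantor set is a compact totally disconnected metrizable space without isolated points; fix a compatible metric $D$ on it. An action $\Phi:G\to \mathrm{Homeo}(X)$ is minimal if every orbit is dense, and equicontinuous if for every $\epsilon>0$ there is $\delta>0$ such that $D(x,y)<\delta$ implies $D(\Phi(g)(x),\Phi(g)(y))<\epsilon$ for all $g\in G$. The action is locally quasi-analytic (LQA) if there is $\epsilon>0$ such that for any open $U\subset X$ with $\mathrm{diam}(U)<\epsilon$, any $g_1,g_2\in G$ and any nonempty open $V\subset U$, $g_1|_V=g_2|_V$ implies $g_1|_U=g_2|_U$ (restrictions of the corresponding homeomorphisms). An element $g\in G$ is non-Hausdorff if there is $x\in X$ with $g\cdot x=x$ such that $g$ is not the identity map on any open neighborhood of $x$, and every open neighborhood $W$ of $x$ contains a nonempty open set $O$ with $g|_O=\mathrm{id}$. *)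

theory Defs
  imports "HOL-Analysis.Analysis" "HOL-Algebra.Group_Action" "HOL-Algebra.Generated_Groups"
begin

definition totally_disconnected_space :: "'a topology \<Rightarrow> bool" where
  "totally_disconnected_space X \<longleftrightarrow> (\<forall>S. connectedin X S \<longrightarrow> (\<exists>a. S \<subseteq> {a}))"

definition cantor_space :: "'a topology \<Rightarrow> bool" where
  "cantor_space X \<longleftrightarrow>
     topspace X \<noteq> {} \<and> compact_space X \<and> totally_disconnected_space X \<and> metrizable_space X \<and>
     (\<forall>x \<in> topspace X. \<not> openin X {x})"

definition compatible_metric :: "'a topology \<Rightarrow> ('a \<Rightarrow> 'a \<Rightarrow> real) \<Rightarrow> bool" where
  "compatible_metric X D \<longleftrightarrow>
     Metric_space (topspace X) D \<and> Metric_space.mtopology (topspace X) D = X"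

text \<open>The library's \<^const>\<open>diameter\<close> is only available for the type class of metric spaces.\<close>

definition mdiam :: "('a \<Rightarrow> 'a \<Rightarrow> real) \<Rightarrow> 'a set \<Rightarrow> real" where
  "mdiam D S = (if S = {} then 0 else SUP (x,y) \<in> S \<times> S. D x y)"

definition finitely_generated_group :: "('g, 'm) monoid_scheme \<Rightarrow> bool" where
  "finitely_generated_group G \<longleftrightarrow>
     group G \<and> (\<exists>S. finite S \<and> S \<subseteq> carrier G \<and> generate G S = carrier G)"

text \<open>A homomorphism from \<open>G\<close> to the homeomorphism group of \<open>X\<close>, not required to be injective.
  The group is discrete, so no continuity in the group variable is imposed.\<close>

definition action_by_homeos ::
    "'a topology \<Rightarrow> ('g, 'm) monoid_scheme \<Rightarrow> ('g \<Rightarrow> 'a \<Rightarrow> 'a) \<Rightarrow> bool" where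
  "action_by_homeos X G \<Phi> \<longleftrightarrow>
     group_action G (topspace X) \<Phi> \<and> (\<forall>g \<in> carrier G. homeomorphic_map X X (\<Phi> g))"

definition minimal_action ::
    "'a topology \<Rightarrow> ('g, 'm) monoid_scheme \<Rightarrow> ('g \<Rightarrow> 'a \<Rightarrow> 'a) \<Rightarrow> bool" where
  "minimal_action X G \<Phi> \<longleftrightarrow>
     (\<forall>x \<in> topspace X. X closure_of (orbit G \<Phi> x) = topspace X)"

definition equicontinuous_action ::
    "'a topology \<Rightarrow> ('a \<Rightarrow> 'a \<Rightarrow> real) \<Rightarrow> ('g, 'm) monoid_scheme \<Rightarrow> ('g \<Rightarrow> 'a \<Rightarrow> 'a) \<Rightarrow> bool" where
  "equicontinuous_action X D G \<Phi> \<longleftrightarrow>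
     (\<forall>\<epsilon>>0. \<exists>\<delta>>0. \<forall>x \<in> topspace X. \<forall>y \<in> topspace X. D x y < \<delta> \<longrightarrow>
        (\<forall>g \<in> carrier G. D (\<Phi> g x) (\<Phi> g y) < \<epsilon>))"

definition locally_quasi_analytic ::
    "'a topology \<Rightarrow> ('a \<Rightarrow> 'a \<Rightarrow> real) \<Rightarrow> ('g, 'm) monoid_scheme \<Rightarrow> ('g \<Rightarrow> 'a \<Rightarrow> 'a) \<Rightarrow> bool" where
  "locally_quasi_analytic X D G \<Phi> \<longleftrightarrow>
     (\<exists>\<epsilon>>0. \<forall>U. openin X U \<and> mdiam D U < \<epsilon> \<longrightarrow>
        (\<forall>g1 \<in> carrier G. \<forall>g2 \<in> carrier G. \<forall>V. openin X V \<and> V \<noteq> {} \<and> V \<subseteq> U \<longrightarrow>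
           (\<forall>x \<in> V. \<Phi> g1 x = \<Phi> g2 x) \<longrightarrow> (\<forall>x \<in> U. \<Phi> g1 x = \<Phi> g2 x)))"

definition non_Hausdorff_element :: "'a topology \<Rightarrow> ('g \<Rightarrow> 'a \<Rightarrow> 'a) \<Rightarrow> 'g \<Rightarrow> bool" where
  "non_Hausdorff_element X \<Phi> g \<longleftrightarrow>
     (\<exists>x \<in> topspace X. \<Phi> g x = x \<and>
        (\<forall>W. openin X W \<and> x \<in> W \<longrightarrow> \<not> (\<forall>y \<in> W. \<Phi> g y = y)) \<and>
        (\<forall>W. openin X W \<and> x \<in> W \<longrightarrow>
           (\<exists>V. openin X V \<and> V \<noteq> {} \<and> V \<subseteq> W \<and> (\<forall>y \<in> V. \<Phi> g y = y))))"

text \<open>Equicontinuity and local quasi-analyticity refer to a fixed compatible metric on \<open>X\<close>. Since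
  \<open>X\<close> is compact, neither depends on its choice; below they are therefore asserted for every
  compatible metric. Metrizability of \<open>X\<close> is part of \<^const>\<open>cantor_space\<close>, so the quantification
  over metrics is never vacuous.\<close>

definition non_LQA_action ::
    "'a topology \<Rightarrow> ('g, 'm) monoid_scheme \<Rightarrow> ('g \<Rightarrow> 'a \<Rightarrow> 'a) \<Rightarrow> bool" where
  "non_LQA_action X G \<Phi> \<longleftrightarrow>
     cantor_space X \<and> finitely_generated_group G \<and> action_by_homeos X G \<Phi> \<and>
     minimal_action X G \<Phi> \<and>
     (\<forall>D. compatible_metric X D \<longrightarrow>
        equicontinuous_action X D G \<Phi> \<and> \<not> locally_quasi_analytic X D G \<Phi>)"

definition non_LQA_with_non_Hausdorff ::
    "('a topology \<times> 'g monoid \<times> ('g \<Rightarrow> 'a \<Rightarrow> 'a)) set" where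
  "non_LQA_with_non_Hausdorff =
     {(X, G, \<Phi>). non_LQA_action X G \<Phi> \<and> (\<exists>g \<in> carrier G. non_Hausdorff_element X \<Phi> g)}"

definition non_LQA_without_non_Hausdorff ::
    "('a topology \<times> 'g monoid \<times> ('g \<Rightarrow> 'a \<Rightarrow> 'a)) set" where
  "non_LQA_without_non_Hausdorff =
     {(X, G, \<Phi>). non_LQA_action X G \<Phi> \<and> \<not> (\<exists>g \<in> carrier G. non_Hausdorff_element X \<Phi> g)}"

text \<open>HOL cannot quantify existentially over types, so concrete carrier types are fixed for spaces
  and groups. This loses no generality: every Cantor set is homeomorphic to a subspace of
  \<open>nat \<Rightarrow> nat\<close>, and every finitely generated group, being countable, is isomorphic to one whose
  carrier lies in any given infinite type.\<close>

type_synonym point = "nat \<Rightarrow> nat"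
type_synonym group_elem = "point \<Rightarrow> point"

end

theory Submission
  imports Defs
begin

text \<open>
  Both classes are inhabited by self-similar groups acting on infinite binary sequences.

  The example without non-Hausdorff elements is the Basilica group, generated by
  \<open>a(0w) = 0w\<close>, \<open>a(1w) = 1b(w)\<close> and \<open>b(0w) = 1w\<close>, \<open>b(1w) = 0a(w)\<close>. All its elements preserve
  common prefixes, so the action is equicontinuous, and the powers of \<open>ab\<close> carry any finite
  prefix to any other of the same length, so the action is minimal. The generator \<open>a\<close> is
  trivial on one half of the space and nontrivial on the other, and \<open>a\<^sup>2\<close> acts on the cylinder of \<open>11\<close> by \<open>a\<close> itself. Hence the powers
  \<open>a, a\<^sup>2, a\<^sup>4, \<dots>\<close> repeat this behaviour at every scale and the action is not LQA.

  The group is contracting: behind any sufficiently long prefix, every element acts on the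
  remaining digits by one of the seven elements \<open>1\<close>, \<open>a\<close>, \<open>a\<inverse>\<close>, \<open>b\<close>, \<open>b\<inverse>\<close>, \<open>ba\<inverse>\<close>, \<open>ab\<inverse>\<close>. Each of
  them either changes the first digit, and then has no fixed point, or has an open set of fixed
  points. Therefore every element of the group fixes a neighbourhood of each of its fixed points,
  and none is non-Hausdorff (\<open>contracted_Basilica_group\<close>, \<open>contracted_fixed_points_open\<close>).

  Equicontinuity, minimality and failure of LQA survive the adjunction of further
  prefix-preserving generators (\<open>non_LQA_automaton_group\<close>). For the other class it is
  therefore enough to adjoin one non-Hausdorff generator \<open>d\<close>, defined by \<open>d(0w) = 0w\<close>,
  \<open>d(1w) = 1e(w)\<close>, where \<open>e(1w) = 1d(w)\<close> and \<open>e(0w)\<close> is \<open>0w\<close> with the first digit of \<open>w\<close> flipped. Every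
  neighbourhood of its fixed point \<open>111\<dots>\<close> contains cylinders of \<open>1\<dots>10\<close> on which \<open>d\<close> is the
  identity and others, with the opposite parity of the number of ones, on which it is not.
\<close>

section \<open>The Cantor set of binary sequences\<close>

definition binary_sequences :: "point set" where
  "binary_sequences = {x. \<forall>n. x n = 0 \<or> x n = 1}"

definition binary_space :: "point topology" where
  "binary_space = product_topology (\<lambda>_. discrete_topology {0, 1}) UNIV"

definition agree :: "nat \<Rightarrow> point \<Rightarrow> point \<Rightarrow> bool" where
  "agree n x y \<longleftrightarrow> (\<forall>i<n. x i = y i)"

definition cylinder :: "nat \<Rightarrow> point \<Rightarrow> point set" where
  "cylinder n x = {y \<in> binary_sequences. agree n x y}"

abbreviation cons_digit :: "nat \<Rightarrow> point \<Rightarrow> point" (infixr "##" 65) where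
  "i ## x \<equiv> case_nat i x"

lemma agree_refl [simp]: "agree n x x"
  by (simp add: agree_def)

lemma agree_sym: "agree n x y \<Longrightarrow> agree n y x"
  by (simp add: agree_def)

lemma agree_trans: "agree n x y \<Longrightarrow> agree n y z \<Longrightarrow> agree n x z"
  by (simp add: agree_def)

lemma agree_mono: "agree n x y \<Longrightarrow> m \<le> n \<Longrightarrow> agree m x y"
  by (simp add: agree_def)

lemma agree_cons [simp]: "agree (Suc n) (i ## x) (j ## y) \<longleftrightarrow> i = j \<and> agree n x y"
  by (auto simp: agree_def less_Suc_eq_0_disj)

lemma all_nat_split: "(\<forall>n. P n) \<longleftrightarrow> P 0 \<and> (\<forall>n. P (Suc n))"
  by (metis not0_implies_Suc)

lemma cons_eq_iff [simp]: "i ## x = j ## y \<longleftrightarrow> i = j \<and> x = y"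
  unfolding fun_eq_iff by (subst all_nat_split) simp

lemma cons_binary [simp]:
  "i ## x \<in> binary_sequences \<longleftrightarrow> (i = 0 \<or> i = 1) \<and> x \<in> binary_sequences"
  unfolding binary_sequences_def mem_Collect_eq
  by (subst all_nat_split) simp

lemma binary_cases:
  assumes "x \<in> binary_sequences"
  obtains i y where "x = i ## y" "i = 0 \<or> i = 1" "y \<in> binary_sequences"
proof
  show "x = x 0 ## (\<lambda>n. x (Suc n))"
    by (auto simp: fun_eq_iff split: nat.split)
qed (use assms in \<open>auto simp: binary_sequences_def\<close>)

lemma mem_cylinder: "y \<in> cylinder n x \<longleftrightarrow> y \<in> binary_sequences \<and> agree n x y"
  by (simp add: cylinder_def)

lemma in_cylinder_cons:
  assumes "y \<in> cylinder (Suc n) (i ## x)"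
  obtains y' where "y = i ## y'" "y' \<in> cylinder n x"
proof -
  have "y \<in> binary_sequences"
    using assms by (simp add: mem_cylinder)
  then obtain j y' where y: "y = j ## y'" "y' \<in> binary_sequences"
    by (rule binary_cases)
  then show thesis
    using assms that [of y'] by (simp add: mem_cylinder)
qed

lemma topspace_binary_space [simp]: "topspace binary_space = binary_sequences"
  by (simp add: binary_space_def binary_sequences_def PiE_UNIV_domain Pi_def)

lemma openin_binary_space_iff:
  "openin binary_space U \<longleftrightarrow>
     U \<subseteq> binary_sequences \<and> (\<forall>x\<in>U. \<exists>n. cylinder n x \<subseteq> U)"
proof
  assume U: "openin binary_space U"
  have "\<exists>n. cylinder n x \<subseteq> U" if x: "x \<in> U" for x
  proof -
    obtain V where fin: "finite {i. V i \<noteq> {0, 1::nat}}" and xV: "x \<in> Pi\<^sub>E UNIV V"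
      and VU: "Pi\<^sub>E UNIV V \<subseteq> U"
      using U x unfolding binary_space_def openin_product_topology_alt topspace_discrete_topology
      by (metis (mono_tags, lifting) Collect_cong UNIV_I)
    obtain n where n: "\<And>i. V i \<noteq> {0, 1} \<Longrightarrow> i < n"
      using fin unfolding finite_nat_set_iff_bounded by blast
    have "cylinder n x \<subseteq> Pi\<^sub>E UNIV V"
    proof
      fix y assume y: "y \<in> cylinder n x"
      have "y i \<in> V i" for i
      proof (cases "V i = {0, 1}")
        case True
        then show ?thesis
          using y by (auto simp: mem_cylinder binary_sequences_def)
      next
        case False
        then have "y i = x i"
          using n y by (simp add: mem_cylinder agree_def)
        then show ?thesis
          using xV by auto
      qed
      then show "y \<in> Pi\<^sub>E UNIV V"
        by auto
    qed
    with VU show ?thesis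
      by blast
  qed
  then show "U \<subseteq> binary_sequences \<and> (\<forall>x\<in>U. \<exists>n. cylinder n x \<subseteq> U)"
    using openin_subset [OF U] by auto
next
  assume R: "U \<subseteq> binary_sequences \<and> (\<forall>x\<in>U. \<exists>n. cylinder n x \<subseteq> U)"
  have "\<exists>V. finite {i. V i \<noteq> {0, 1::nat}} \<and> (\<forall>i. V i \<subseteq> {0, 1}) \<and>
          x \<in> Pi\<^sub>E UNIV V \<and> Pi\<^sub>E UNIV V \<subseteq> U" if x: "x \<in> U" for x
  proof -
    obtain n where n: "cylinder n x \<subseteq> U"
      using R x by blast
    have xb: "x \<in> binary_sequences"
      using R x by blast
    let ?V = "\<lambda>i. if i < n then {x i} else {0, 1::nat}"
    have "finite {i. ?V i \<noteq> {0, 1}}"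
      by (rule finite_subset [of _ "{..<n}"]) auto
    moreover have sub: "\<forall>i. ?V i \<subseteq> {0, 1}"
      using xb by (auto simp: binary_sequences_def)
    moreover have "x \<in> Pi\<^sub>E UNIV ?V"
      using xb by (auto simp: binary_sequences_def)
    moreover have "Pi\<^sub>E UNIV ?V \<subseteq> cylinder n x"
    proof
      fix y assume y: "y \<in> Pi\<^sub>E UNIV ?V"
      then have yi: "y i \<in> ?V i" for i
        by (rule PiE_mem) simp
      have "y i = 0 \<or> y i = 1" for i
        using yi [of i] sub by blast
      moreover have "y i = x i" if "i < n" for i
        using yi [of i] that by simp
      ultimately show "y \<in> cylinder n x"
        by (simp add: mem_cylinder agree_def binary_sequences_def)
    qed
    ultimately show ?thesis
      using n by (intro exI [of _ ?V]) blast
  qed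
  then show "openin binary_space U"
    unfolding binary_space_def openin_product_topology_alt topspace_discrete_topology
      openin_discrete_topology by (simp only: UNIV_I simp_thms ball_simps) blast
qed

lemma openin_cylinder [simp]: "openin binary_space (cylinder n x)"
  unfolding openin_binary_space_iff mem_cylinder
  by (auto simp: cylinder_def intro!: exI [of _ n] intro: agree_trans)

lemma compact_binary_space: "compact_space binary_space"
  by (simp add: binary_space_def compact_space_product_topology compact_space_discrete_topology)

lemma cantor_binary_space: "cantor_space binary_space"
  unfolding cantor_space_def
proof (intro conjI ballI)
  show "topspace binary_space \<noteq> {}"
    by (auto simp: binary_sequences_def)
  show "metrizable_space binary_space"
    by (simp add: binary_space_def metrizable_space_product_topology)
  show "totally_disconnected_space binary_space"
    unfolding totally_disconnected_space_def
  proof (intro allI impI)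
    fix S assume S: "connectedin binary_space S"
    have "\<exists>a. (\<lambda>x. x i) ` S \<subseteq> {a}" for i
    proof -
      have "continuous_map binary_space (discrete_topology {0, 1::nat}) (\<lambda>x. x i)"
        unfolding binary_space_def
        using continuous_map_product_projection [of i UNIV "\<lambda>_. discrete_topology {0, 1::nat}"]
        by simp
      then show ?thesis
        using connectedin_continuous_map_image [OF _ S] connectedin_discrete_topology by blast
    qed
    then have "x = y" if "x \<in> S" "y \<in> S" for x y
      using that by (intro ext) blast
    then show "\<exists>a. S \<subseteq> {a}"
      by blast
  qed
  fix x assume x: "x \<in> topspace binary_space"
  show "\<not> openin binary_space {x}"
  proof
    assume "openin binary_space {x}"
    then obtain n where n: "cylinder n x \<subseteq> {x}"
      unfolding openin_binary_space_iff by blast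
    \<comment> \<open>A cylinder is not a singleton, since any later digit can be flipped.\<close>
    have "x(n := 1 - x n) \<in> cylinder n x"
      using x by (auto simp: mem_cylinder agree_def binary_sequences_def)
    then have "x(n := 1 - x n) = x"
      using n by blast
    then have "1 - x n = x n"
      by (metis fun_upd_same)
    then show False
      by presburger
  qed
qed (rule compact_binary_space)

text \<open>By compactness, being close in a compatible metric and having a long common prefix are
  uniformly equivalent. The two directions reduce every metric condition on an action to a
  condition on common prefixes.\<close>

lemma cylinders_uniformly_small:
  assumes D: "compatible_metric binary_space D" and e: "\<epsilon> > 0"
  shows "\<exists>n. \<forall>x\<in>binary_sequences. \<forall>y\<in>binary_sequences. agree n x y \<longrightarrow> D x y < \<epsilon>"
proof -
  interpret M: Metric_space binary_sequences D
    using D by (simp add: compatible_metric_def)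
  have top: "M.mtopology = binary_space"
    using D by (simp add: compatible_metric_def)
  have "\<exists>n. cylinder n x \<subseteq> M.mball x (\<epsilon>/2)" if "x \<in> binary_sequences" for x
  proof -
    have "openin binary_space (M.mball x (\<epsilon>/2))"
      using M.openin_mball [of x "\<epsilon>/2"] unfolding top .
    then show ?thesis
      using that e unfolding openin_binary_space_iff by (meson M.centre_in_mball_iff half_gt_zero)
  qed
  then obtain N where N: "\<And>x. x \<in> binary_sequences \<Longrightarrow> cylinder (N x) x \<subseteq> M.mball x (\<epsilon>/2)"
    by metis
  let ?C = "(\<lambda>x. cylinder (N x) x) ` binary_sequences"
  have "binary_sequences \<subseteq> \<Union>?C"
    by (auto simp: mem_cylinder)
  moreover have "\<forall>U\<in>?C. openin binary_space U"
    by simp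
  ultimately obtain F where F: "finite F" "F \<subseteq> ?C" "binary_sequences \<subseteq> \<Union>F"
    using compact_binary_space unfolding compact_space_alt topspace_binary_space by meson
  obtain K where K: "K \<subseteq> binary_sequences" "finite K"
    and FK: "F = (\<lambda>x. cylinder (N x) x) ` K"
    using finite_subset_image [OF F(1,2)] by blast
  have cov: "binary_sequences \<subseteq> (\<Union>x\<in>K. cylinder (N x) x)"
    using F(3) unfolding FK .
  show ?thesis
  proof (intro exI ballI impI)
    fix x y
    assume xy: "x \<in> binary_sequences" "y \<in> binary_sequences" "agree (Max (insert 0 (N ` K))) x y"
    obtain k where k: "k \<in> K" "x \<in> cylinder (N k) k"
      using cov xy by blast
    have "N k \<le> Max (insert 0 (N ` K))"
      using k K by (intro Max_ge) auto
    then have "y \<in> cylinder (N k) k"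
      using k xy by (meson agree_mono agree_trans mem_cylinder)
    then have "y \<in> M.mball k (\<epsilon>/2)" "x \<in> M.mball k (\<epsilon>/2)"
      using N k K by blast+
    then have "D k y < \<epsilon>/2" "D k x < \<epsilon>/2" "k \<in> binary_sequences"
      by simp_all
    then show "D x y < \<epsilon>"
      using M.triangle [of x k y] M.commute [of x k] xy by linarith
  qed
qed

lemma near_points_agree:
  assumes D: "compatible_metric binary_space D"
  shows "\<exists>\<delta>>0. \<forall>x\<in>binary_sequences. \<forall>y\<in>binary_sequences. D x y < \<delta> \<longrightarrow> agree n x y"
proof -
  interpret M: Metric_space binary_sequences D
    using D by (simp add: compatible_metric_def)
  have top: "M.mtopology = binary_space"
    using D by (simp add: compatible_metric_def)
  have "compactin M.mtopology binary_sequences"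
    using compact_binary_space by (simp add: top compact_space_def)
  moreover have "binary_sequences \<subseteq> \<Union>(cylinder n ` binary_sequences)"
    by (auto simp: mem_cylinder)
  moreover have "\<And>C. C \<in> cylinder n ` binary_sequences \<Longrightarrow> openin M.mtopology C"
    by (auto simp: top)
  ultimately obtain \<delta> where d: "\<delta> > 0"
    "\<And>x. x \<in> binary_sequences \<Longrightarrow> \<exists>C\<in>cylinder n ` binary_sequences. M.mball x \<delta> \<subseteq> C"
    using M.lebesgue_number [of binary_sequences "cylinder n ` binary_sequences"] by blast
  show ?thesis
  proof (intro exI [of _ \<delta>] conjI ballI impI)
    fix x y assume xy: "x \<in> binary_sequences" "y \<in> binary_sequences" "D x y < \<delta>"
    obtain z where "M.mball x \<delta> \<subseteq> cylinder n z"
      using d xy by blast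
    then have "x \<in> cylinder n z" "y \<in> cylinder n z"
      using xy d by auto
    then show "agree n x y"
      by (meson agree_sym agree_trans mem_cylinder)
  qed (rule d)
qed

section \<open>Groups of prefix-preserving bijections\<close>

text \<open>These are the isometries of the digit metric, or the automorphisms of the binary
  tree.\<close>

definition prefix_preserving :: "(point \<Rightarrow> point) \<Rightarrow> bool" where
  "prefix_preserving f \<longleftrightarrow> (\<forall>x\<in>binary_sequences. f x \<in> binary_sequences) \<and>
     (\<forall>n. \<forall>x\<in>binary_sequences. \<forall>y\<in>binary_sequences. agree n x y \<longrightarrow> agree n (f x) (f y))"

abbreviation generated_group :: "group_elem set \<Rightarrow> group_elem monoid" where
  "generated_group S \<equiv>
     BijGroup binary_sequences \<lparr>carrier := generate (BijGroup binary_sequences) S\<rparr>"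

lemma continuous_map_prefix_preserving:
  assumes "prefix_preserving f"
  shows "continuous_map binary_space binary_space f"
  unfolding continuous_map_def
proof (intro conjI allI impI)
  show "f \<in> topspace binary_space \<rightarrow> topspace binary_space"
    using assms by (simp add: prefix_preserving_def)
  fix U assume "openin binary_space U"
  then show "openin binary_space {x \<in> topspace binary_space. f x \<in> U}"
    using assms unfolding openin_binary_space_iff prefix_preserving_def
    by (simp add: subset_iff mem_cylinder) meson
qed

context
  fixes S :: "group_elem set"
  assumes S_Bij: "S \<subseteq> Bij binary_sequences"
begin

interpretation B: group "BijGroup binary_sequences"
  by (rule group_BijGroup)

lemma S_carrier: "S \<subseteq> carrier (BijGroup binary_sequences)"
  using S_Bij by (simp add: BijGroup_def)

lemma subgroup_generate_S: "subgroup (generate (BijGroup binary_sequences) S) (BijGroup binary_sequences)"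
  by (rule B.generate_is_subgroup [OF S_carrier])

lemma group_generated_group: "group (generated_group S)"
  by (rule B.subgroup_imp_group [OF subgroup_generate_S])

lemma generated_group_Bij: "g \<in> carrier (generated_group S) \<Longrightarrow> g \<in> Bij binary_sequences"
  using B.generate_incl [OF S_carrier] by (auto simp: BijGroup_def)

lemma finitely_generated_generated_group:
  assumes "finite S"
  shows "finitely_generated_group (generated_group S)"
proof -
  have S_gen: "S \<subseteq> generate (BijGroup binary_sequences) S"
    by (auto intro: generate.incl)
  from this have "generate (generated_group S) S = carrier (generated_group S)"
    using B.generate_consistent [OF _ subgroup_generate_S, of S] by simp
  then show ?thesis
    using assms group_generated_group S_gen by (auto simp: finitely_generated_group_def)
qed

lemma group_action_generated_group: "group_action (generated_group S) binary_sequences (\<lambda>g. g)"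
proof -
  have "(\<lambda>g. g) \<in> hom (generated_group S) (BijGroup binary_sequences)"
    using B.generate_incl [OF S_carrier] by (auto simp: hom_def)
  then show ?thesis
    unfolding group_action_def group_hom_def group_hom_axioms_def
    using group_generated_group group_BijGroup by blast
qed

lemma mult_generated_group:
  assumes "g \<in> carrier (generated_group S)" "h \<in> carrier (generated_group S)"
  shows "g \<otimes>\<^bsub>BijGroup binary_sequences\<^esub> h = compose binary_sequences g h"
proof -
  have "g \<in> Bij binary_sequences" "h \<in> Bij binary_sequences"
    by (rule generated_group_Bij; fact)+
  then show ?thesis
    by (simp add: BijGroup_def)
qed

lemma id_in_generated_group: "restrict id binary_sequences \<in> carrier (generated_group S)"
proof -
  have "\<one>\<^bsub>BijGroup binary_sequences\<^esub> = restrict id binary_sequences"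
    by (simp add: BijGroup_def id_def)
  then show ?thesis
    using generate.one [of "BijGroup binary_sequences" S] by simp
qed

lemma comp_in_generated_group:
  assumes "restrict f binary_sequences \<in> carrier (generated_group S)"
    and "restrict g binary_sequences \<in> carrier (generated_group S)"
  shows "restrict (f \<circ> g) binary_sequences \<in> carrier (generated_group S)"
proof -
  have "g x \<in> binary_sequences" if "x \<in> binary_sequences" for x
    using Bij_imp_funcset [OF generated_group_Bij [OF assms(2)]] that by (auto simp: Pi_iff)
  then have "compose binary_sequences (restrict f binary_sequences) (restrict g binary_sequences)
      = restrict (f \<circ> g) binary_sequences"
    by (auto simp: compose_def)
  moreover have "restrict f binary_sequences \<otimes>\<^bsub>BijGroup binary_sequences\<^esub> restrict g binary_sequences
      \<in> carrier (generated_group S)"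
    using assms by (simp add: generate.eng)
  ultimately show ?thesis
    by (simp only: mult_generated_group [OF assms])
qed

lemma funpow_in_generated_group:
  assumes "restrict f binary_sequences \<in> carrier (generated_group S)"
  shows "restrict (f ^^ n) binary_sequences \<in> carrier (generated_group S)"
proof (induction n)
  case 0
  then show ?case
    by (simp only: funpow.simps id_in_generated_group)
next
  case (Suc n)
  then show ?case
    unfolding funpow.simps by (rule comp_in_generated_group [OF assms])
qed

end

lemma inv_BijGroup_restrict:
  assumes "\<And>x. x \<in> A \<Longrightarrow> f x \<in> A \<and> f' x \<in> A \<and> f' (f x) = x \<and> f (f' x) = x"
  shows "restrict f A \<in> Bij A" "inv\<^bsub>BijGroup A\<^esub> (restrict f A) = restrict f' A"
proof -
  have bij: "bij_betw f A A" "bij_betw f' A A"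
    by (rule bij_betwI [where g = f'] bij_betwI [where g = f]; simp add: assms)+
  then have Bij: "restrict f A \<in> Bij A" "restrict f' A \<in> Bij A"
    by (auto simp: Bij_def cong: bij_betw_cong)
  then show "restrict f A \<in> Bij A"
    by simp
  have "restrict f' A \<otimes>\<^bsub>BijGroup A\<^esub> restrict f A = \<one>\<^bsub>BijGroup A\<^esub>"
    using Bij assms by (auto simp: BijGroup_def compose_def)
  then show "inv\<^bsub>BijGroup A\<^esub> (restrict f A) = restrict f' A"
    using Bij by (intro group.inv_equality [OF group_BijGroup]) (auto simp: BijGroup_def)
qed

section \<open>A finite automaton acting on binary sequences\<close>

text \<open>The states are the trivial map, the Basilica generators with their inverses, the two products
  \<open>ba\<inverse>\<close> and \<open>ab\<inverse>\<close> that complete the nucleus, and the maps \<open>d\<close>, \<open>e\<close> and the flip of the first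
  digit. Including the nucleus among the states lets identities in the group be verified as
  relations between states.\<close>

datatype state =
  Unit | Bas_a | Bas_a_inv | Bas_b | Bas_b_inv | Bas_b_a_inv | Bas_a_b_inv | Germ | Germ_odd | Flip

definition flipping :: "state \<Rightarrow> bool" where
  "flipping q \<longleftrightarrow> q \<in> {Bas_b, Bas_b_inv, Bas_b_a_inv, Bas_a_b_inv, Flip}"

definition output_digit :: "state \<Rightarrow> nat \<Rightarrow> nat" where
  "output_digit q i = (if flipping q then 1 - i else i)"

fun residual :: "state \<Rightarrow> nat \<Rightarrow> state" where
  "residual Unit i = Unit"
| "residual Bas_a i = (if i = 0 then Unit else Bas_b)"
| "residual Bas_a_inv i = (if i = 0 then Unit else Bas_b_inv)"
| "residual Bas_b i = (if i = 0 then Unit else Bas_a)"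
| "residual Bas_b_inv i = (if i = 0 then Bas_a_inv else Unit)"
| "residual Bas_b_a_inv i = (if i = 0 then Unit else Bas_a_b_inv)"
| "residual Bas_a_b_inv i = (if i = 0 then Bas_b_a_inv else Unit)"
| "residual Germ i = (if i = 0 then Unit else Germ_odd)"
| "residual Germ_odd i = (if i = 0 then Flip else Germ)"
| "residual Flip i = Unit"

primrec act :: "state \<Rightarrow> point \<Rightarrow> point" where
  "act q x 0 = output_digit q (x 0)"
| "act q x (Suc n) = act (residual q (x 0)) (\<lambda>m. x (Suc m)) n"

lemma act_cons: "act q (i ## x) = output_digit q i ## act (residual q i) x"
proof
  show "act q (i ## x) n = (output_digit q i ## act (residual q i) x) n" for n
    by (cases n) auto
qed

lemma act_binary: "x \<in> binary_sequences \<Longrightarrow> act q x \<in> binary_sequences"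
proof -
  have "x \<in> binary_sequences \<Longrightarrow> act q x n = 0 \<or> act q x n = 1" for n
  proof (induction n arbitrary: q x)
    case 0
    then show ?case
      by (auto simp: output_digit_def binary_sequences_def)
  next
    case (Suc n)
    have "(\<lambda>m. x (Suc m)) \<in> binary_sequences"
      using Suc.prems by (simp add: binary_sequences_def)
    then show ?case
      using Suc.IH by simp
  qed
  then show "x \<in> binary_sequences \<Longrightarrow> act q x \<in> binary_sequences"
    by (simp add: binary_sequences_def)
qed

lemma act_agree: "agree n x y \<Longrightarrow> agree n (act q x) (act q y)"
proof -
  have "\<forall>j\<le>i. x j = y j \<Longrightarrow> act q x i = act q y i" for i
  proof (induction i arbitrary: q x y)
    case (Suc i)
    have "act (residual q (x 0)) (\<lambda>m. x (Suc m)) i = act (residual q (x 0)) (\<lambda>m. y (Suc m)) i"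
      using Suc.prems by (intro Suc.IH) auto
    then show ?case
      using Suc.prems by simp
  qed simp
  then show "agree n x y \<Longrightarrow> agree n (act q x) (act q y)"
    by (simp add: agree_def)
qed

lemma prefix_preserving_act: "prefix_preserving (act q)"
  by (simp add: prefix_preserving_def act_binary act_agree)

fun inverse_state :: "state \<Rightarrow> state" where
  "inverse_state Bas_a = Bas_a_inv"
| "inverse_state Bas_a_inv = Bas_a"
| "inverse_state Bas_b = Bas_b_inv"
| "inverse_state Bas_b_inv = Bas_b"
| "inverse_state Bas_b_a_inv = Bas_a_b_inv"
| "inverse_state Bas_a_b_inv = Bas_b_a_inv"
| "inverse_state q = q"

text \<open>Products of two states that are again given by a single state. The identities involving
  \<open>Bas_b_a_inv\<close> and \<open>Bas_a_b_inv\<close> occur in residuals of each other, so they are collected into one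
  relation closed under passing to residuals (\<open>fusible_residual\<close>) and proved simultaneously.\<close>

definition fusible :: "(state \<times> state \<times> state) set" where
  "fusible = {(s, q, r). s = Unit \<and> q = r \<or> q = Unit \<and> s = r \<or> s = inverse_state q \<and> r = Unit \<or>
     (s, q, r) \<in> {(Bas_b, Bas_a_inv, Bas_b_a_inv), (Bas_a, Bas_b_inv, Bas_a_b_inv),
       (Bas_b_inv, Bas_b_a_inv, Bas_a_inv), (Bas_a_inv, Bas_a_b_inv, Bas_b_inv)}}"

lemma fusible_residual:
  assumes "(s, q, r) \<in> fusible" "i = 0 \<or> i = 1"
  shows "output_digit s (output_digit q i) = output_digit r i"
    and "(residual s (output_digit q i), residual q i, residual r i) \<in> fusible"
proof -
  consider "s = Unit" "q = r" | "q = Unit" "s = r" | "s = inverse_state q" "r = Unit"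
    | "(s, q, r) \<in> {(Bas_b, Bas_a_inv, Bas_b_a_inv), (Bas_a, Bas_b_inv, Bas_a_b_inv),
       (Bas_b_inv, Bas_b_a_inv, Bas_a_inv), (Bas_a_inv, Bas_a_b_inv, Bas_b_inv)}"
    using assms(1) unfolding fusible_def mem_Collect_eq prod.case by argo
  then have "output_digit s (output_digit q i) = output_digit r i \<and>
    (residual s (output_digit q i), residual q i, residual r i) \<in> fusible"
  proof cases
    case 1
    then show ?thesis
      by (simp add: fusible_def output_digit_def flipping_def)
  next
    case 2
    then show ?thesis
      by (simp add: fusible_def output_digit_def flipping_def)
  next
    case 3
    then show ?thesis
      using assms(2) by (cases q) (auto simp: fusible_def output_digit_def flipping_def)
  next
    case 4
    then show ?thesis
      using assms(2) unfolding insert_iff empty_iff prod.inject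
      by (elim disjE conjE FalseE) (simp_all add: fusible_def output_digit_def flipping_def)
  qed
  then show "output_digit s (output_digit q i) = output_digit r i"
    "(residual s (output_digit q i), residual q i, residual r i) \<in> fusible"
    by simp_all
qed

lemma act_fusible:
  assumes "(s, q, r) \<in> fusible" "x \<in> binary_sequences"
  shows "act s (act q x) = act r x"
proof
  fix n
  show "act s (act q x) n = act r x n"
    using assms
  proof (induction n arbitrary: s q r x)
    case 0
    then have "x 0 = 0 \<or> x 0 = 1"
      by (simp add: binary_sequences_def)
    then have "output_digit s (output_digit q (x 0)) = output_digit r (x 0)"
      by (rule fusible_residual [OF 0(1)])
    then show ?case
      by simp
  next
    case (Suc n)
    then obtain i y where x: "x = i ## y" "i = 0 \<or> i = 1" "y \<in> binary_sequences"
      using binary_cases by blast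
    have "act (residual s (output_digit q i)) (act (residual q i) y) n = act (residual r i) y n"
      by (rule Suc.IH [OF fusible_residual(2) [OF Suc.prems(1) x(2)] x(3)])
    then show ?case
      by (simp add: x(1) act_cons)
  qed
qed

lemma act_Unit: "act Unit x = x"
proof
  show "act Unit x n = x n" for n
    by (induction n arbitrary: x) (auto simp: output_digit_def flipping_def)
qed

lemma act_inverse_state:
  assumes "x \<in> binary_sequences"
  shows "act (inverse_state q) (act q x) = x" "act q (act (inverse_state q) x) = x"
proof -
  have "(inverse_state q, q, Unit) \<in> fusible" "(q, inverse_state q, Unit) \<in> fusible"
    by (cases q; simp add: fusible_def)+
  then show "act (inverse_state q) (act q x) = x" "act q (act (inverse_state q) x) = x"
    using act_fusible assms by (simp_all add: act_Unit)
qed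

definition homeo :: "state \<Rightarrow> group_elem" where
  "homeo q = restrict (act q) binary_sequences"

lemma homeo_Bij: "homeo q \<in> Bij binary_sequences"
  and inv_homeo: "inv\<^bsub>BijGroup binary_sequences\<^esub> (homeo q) = homeo (inverse_state q)"
  unfolding homeo_def
  by (rule inv_BijGroup_restrict [where f' = "act (inverse_state q)"];
      simp add: act_binary act_inverse_state)+

section \<open>Actions generated by states of the automaton\<close>

abbreviation automaton_group :: "state set \<Rightarrow> group_elem monoid" where
  "automaton_group Q \<equiv> generated_group (homeo ` Q)"

lemma homeo_image_Bij: "homeo ` Q \<subseteq> Bij binary_sequences"
  using homeo_Bij by blast

text \<open>Generation of a subgroup closes under arbitrary products, whereas contraction is only known
  to be inherited under composition with a single generator. Strengthening \<open>P g\<close> to the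
  statement that composition with \<open>g\<close> preserves \<open>P\<close> bridges the two.\<close>

lemma automaton_group_induct:
  assumes g: "g \<in> carrier (automaton_group Q)"
    and cong: "\<And>f f'. P f \<Longrightarrow> (\<And>x. x \<in> binary_sequences \<Longrightarrow> f' x = f x) \<Longrightarrow> P f'"
    and id: "P id"
    and step: "\<And>q f. \<lbrakk>q \<in> Q \<union> inverse_state ` Q; P f; f \<in> binary_sequences \<rightarrow> binary_sequences\<rbrakk>
      \<Longrightarrow> P (act q \<circ> f)"
  shows "P g"
proof -
  have gen: "P (homeo q \<circ> f)"
    if "q \<in> Q \<union> inverse_state ` Q" "P f" "f \<in> binary_sequences \<rightarrow> binary_sequences" for q f
  proof (rule cong [OF step [OF that]])
    fix x assume "x \<in> binary_sequences"
    then have "f x \<in> binary_sequences"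
      using that(3) by blast
    then show "(homeo q \<circ> f) x = (act q \<circ> f) x"
      by (simp add: homeo_def)
  qed
  have all: "\<forall>f. P f \<longrightarrow> f \<in> binary_sequences \<rightarrow> binary_sequences \<longrightarrow> P (g \<circ> f)"
    using g [simplified]
  proof (induction rule: generate.induct)
    case one
    show ?case
    proof (intro allI impI)
      fix f assume f: "P f" "f \<in> binary_sequences \<rightarrow> binary_sequences"
      show "P (\<one>\<^bsub>BijGroup binary_sequences\<^esub> \<circ> f)"
        by (rule cong [OF f(1)]) (use f(2) in \<open>simp add: BijGroup_def Pi_iff\<close>)
    qed
  next
    case (incl h)
    then show ?case
      using gen by blast
  next
    case (inv h)
    then obtain q where "q \<in> Q" and h: "h = homeo q"
      by blast
    then show ?case
      unfolding h inv_homeo using gen by blast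
  next
    case (eng h1 h2)
    have mem: "h1 \<in> carrier (automaton_group Q)" "h2 \<in> carrier (automaton_group Q)"
      using eng by auto
    have h2: "h2 \<in> binary_sequences \<rightarrow> binary_sequences"
      using generated_group_Bij [OF homeo_image_Bij mem(2)] by (rule Bij_imp_funcset)
    show ?case
    proof (intro allI impI)
      fix f assume f: "P f" "f \<in> binary_sequences \<rightarrow> binary_sequences"
      have "h2 \<circ> f \<in> binary_sequences \<rightarrow> binary_sequences"
        using f(2) h2 by (simp add: Pi_iff)
      then have "P (h1 \<circ> (h2 \<circ> f))"
        using eng.IH f by blast
      then show "P ((h1 \<otimes>\<^bsub>BijGroup binary_sequences\<^esub> h2) \<circ> f)"
      proof (rule cong)
        fix x assume "x \<in> binary_sequences"
        then have "f x \<in> binary_sequences"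
          using f(2) by blast
        then show "((h1 \<otimes>\<^bsub>BijGroup binary_sequences\<^esub> h2) \<circ> f) x = (h1 \<circ> (h2 \<circ> f)) x"
          by (simp add: mult_generated_group [OF homeo_image_Bij mem] compose_def)
      qed
    qed
  qed
  have "id \<in> binary_sequences \<rightarrow> binary_sequences"
    by simp
  then have "P (g \<circ> id)"
    using all id by blast
  then show ?thesis
    by simp
qed

lemma prefix_preserving_automaton_group:
  assumes "g \<in> carrier (automaton_group Q)"
  shows "prefix_preserving g"
  using assms
proof (rule automaton_group_induct)
  fix q f
  assume "prefix_preserving f"
  then show "prefix_preserving (act q \<circ> f)"
    using prefix_preserving_act [of q] by (simp add: prefix_preserving_def)
qed (auto simp: prefix_preserving_def)

lemma action_by_homeos_automaton_group:
  "action_by_homeos binary_space (automaton_group Q) (\<lambda>g. g)"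
  unfolding action_by_homeos_def topspace_binary_space
proof (intro conjI ballI)
  show "group_action (automaton_group Q) binary_sequences (\<lambda>g. g)"
    by (rule group_action_generated_group [OF homeo_image_Bij])
next
  fix g assume g: "g \<in> carrier (automaton_group Q)"
  interpret H: group "automaton_group Q"
    by (rule group_generated_group [OF homeo_image_Bij])
  define h where "h = inv\<^bsub>automaton_group Q\<^esub> g"
  have h: "h \<in> carrier (automaton_group Q)"
    unfolding h_def using g by (rule H.inv_closed)
  have "compose binary_sequences h g = \<one>\<^bsub>automaton_group Q\<^esub>"
    "compose binary_sequences g h = \<one>\<^bsub>automaton_group Q\<^esub>"
    using H.l_inv [OF g] H.r_inv [OF g] mult_generated_group [OF homeo_image_Bij h g]
      mult_generated_group [OF homeo_image_Bij g h]
    by (simp_all add: h_def)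
  then have "h (g x) = x" "g (h x) = x" if "x \<in> binary_sequences" for x
    using that by (simp_all add: compose_def BijGroup_def fun_eq_iff) metis+
  then have "homeomorphic_maps binary_space binary_space g h"
    unfolding homeomorphic_maps_def
    using g h by (simp add: continuous_map_prefix_preserving prefix_preserving_automaton_group)
  then show "homeomorphic_map binary_space binary_space g"
    by (rule homeomorphic_maps_imp_map)
qed

lemma equicontinuous_automaton_group:
  assumes D: "compatible_metric binary_space D"
  shows "equicontinuous_action binary_space D (automaton_group Q) (\<lambda>g. g)"
  unfolding equicontinuous_action_def topspace_binary_space
proof (intro allI impI)
  fix \<epsilon> :: real assume \<epsilon>: "\<epsilon> > 0"
  obtain n where n: "\<forall>x\<in>binary_sequences. \<forall>y\<in>binary_sequences. agree n x y \<longrightarrow> D x y < \<epsilon>"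
    using cylinders_uniformly_small [OF D \<epsilon>] by (rule exE)
  obtain \<delta> where \<delta>: "\<delta> > 0"
    "\<forall>x\<in>binary_sequences. \<forall>y\<in>binary_sequences. D x y < \<delta> \<longrightarrow> agree n x y"
    proof -
    from near_points_agree [OF D, of n] show thesis
      by (elim exE conjE) (rule that)
  qed
  show "\<exists>\<delta>>0. \<forall>x\<in>binary_sequences. \<forall>y\<in>binary_sequences. D x y < \<delta> \<longrightarrow>
          (\<forall>g\<in>carrier (automaton_group Q). D (g x) (g y) < \<epsilon>)"
    by (intro exI [of _ \<delta>] conjI ballI impI \<delta>(1) n [rule_format];
        drule prefix_preserving_automaton_group; simp add: prefix_preserving_def \<delta>(2))
qed

lemma homeo_in_automaton_group: "q \<in> Q \<Longrightarrow> homeo q \<in> carrier (automaton_group Q)"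
  by simp (intro generate.incl imageI)

lemma restrict_act_in_automaton_group:
  assumes "q \<in> Q"
  shows "restrict (act q) binary_sequences \<in> carrier (automaton_group Q)"
  using homeo_in_automaton_group [OF assms] by (simp only: homeo_def)

text \<open>The two products \<open>ab\<close> and \<open>ba\<close> are odometers: each moves the first digit, and the square of
  each acts on the two halves of the space by \<open>ab\<close> or \<open>ba\<close> again. So the powers of \<open>ab\<close> alone already
  realize every change of a finite prefix.\<close>

lemma Basilica_powers_transitive:
  assumes "x \<in> binary_sequences" "y \<in> binary_sequences"
    and "c \<in> {act Bas_a \<circ> act Bas_b, act Bas_b \<circ> act Bas_a}"
  shows "\<exists>k. agree n ((c ^^ k) x) y"
  using assms
proof (induction n arbitrary: x y c)
  case 0
  show ?case
    by (simp add: agree_def)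
next
  case (Suc n)
  let ?C = "{act Bas_a \<circ> act Bas_b, act Bas_b \<circ> act Bas_a}"
  have c_binary: "c z \<in> binary_sequences" if "z \<in> binary_sequences" for z
    using that Suc.prems(3) by (auto simp: act_binary)
  obtain j y' where y: "y = j ## y'" "j = 0 \<or> j = 1" "y' \<in> binary_sequences"
    using Suc.prems(2) binary_cases by blast
  have same_digit: "\<exists>k. agree (Suc n) ((c ^^ k) z) y"
    if z: "z \<in> binary_sequences" "z 0 = j" for z
  proof -
    obtain z' where z': "z = j ## z'" "z' \<in> binary_sequences"
      using z binary_cases by (metis nat.case(1))
    obtain c' where c': "c' \<in> ?C" and sq: "\<And>w. c (c (j ## w)) = j ## c' w"
    proof -
      have ab: "(act Bas_a \<circ> act Bas_b) ((act Bas_a \<circ> act Bas_b) (0 ## w)) = 0 ## (act Bas_a \<circ> act Bas_b) w"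
        "(act Bas_a \<circ> act Bas_b) ((act Bas_a \<circ> act Bas_b) (1 ## w)) = 1 ## (act Bas_b \<circ> act Bas_a) w" for w
        by (simp_all add: act_cons act_Unit output_digit_def flipping_def)
      have ba: "(act Bas_b \<circ> act Bas_a) ((act Bas_b \<circ> act Bas_a) (0 ## w)) = 0 ## (act Bas_a \<circ> act Bas_b) w"
        "(act Bas_b \<circ> act Bas_a) ((act Bas_b \<circ> act Bas_a) (1 ## w)) = 1 ## (act Bas_a \<circ> act Bas_b) w" for w
        by (simp_all add: act_cons act_Unit output_digit_def flipping_def)
      have "\<exists>c'\<in>?C. \<forall>w. c (c (j ## w)) = j ## c' w"
        using y(2) Suc.prems(3) ab ba by blast
      then show thesis
        using that by blast
    qed
    obtain k where k: "agree n ((c' ^^ k) z') y'"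
      using Suc.IH [OF z'(2) y(3) c'] by blast
    have "(c ^^ (2 * k)) (j ## w) = j ## (c' ^^ k) w" for w
      by (induction k) (simp_all add: sq)
    then show ?thesis
      using k z' y by (metis agree_cons)
  qed
  show ?case
  proof (cases "x 0 = j")
    case True
    then show ?thesis
      using same_digit Suc.prems by blast
  next
    case False
    have "c x 0 = j"
    proof -
      have "x 0 = 0 \<or> x 0 = 1"
        using Suc.prems(1) by (simp add: binary_sequences_def)
      then have "1 - x 0 = j"
        using False y(2) by auto
      moreover have "c x 0 = 1 - x 0"
        using Suc.prems(3) by (elim insertE emptyE) (simp_all add: output_digit_def flipping_def)
      ultimately show ?thesis
        by simp
    qed
    then obtain k where "agree (Suc n) ((c ^^ k) (c x)) y"
      using same_digit c_binary Suc.prems by blast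
    then have "agree (Suc n) ((c ^^ Suc k) x) y"
      by (simp add: funpow_swap1)
    then show ?thesis
      by blast
  qed
qed

lemma minimal_automaton_group:
  assumes "{Bas_a, Bas_b} \<subseteq> Q"
  shows "minimal_action binary_space (automaton_group Q) (\<lambda>g. g)"
  unfolding minimal_action_def
proof (intro ballI subset_antisym closure_of_subset_topspace subsetI)
  fix x y assume "x \<in> topspace binary_space" "y \<in> topspace binary_space"
  then have x: "x \<in> binary_sequences" and y: "y \<in> binary_sequences"
    by auto
  show "y \<in> binary_space closure_of orbit (automaton_group Q) (\<lambda>g. g) x"
    unfolding in_closure_of
  proof (intro conjI allI impI)
    fix U assume U: "y \<in> U \<and> openin binary_space U"
    then obtain n where n: "cylinder n y \<subseteq> U"
      unfolding openin_binary_space_iff by blast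
    let ?c = "act Bas_a \<circ> act Bas_b"
    obtain k where k: "agree n ((?c ^^ k) x) y"
      using Basilica_powers_transitive [OF x y] by blast
    have "Bas_a \<in> Q" "Bas_b \<in> Q"
      using assms by simp_all
    then have mem: "restrict (?c ^^ k) binary_sequences \<in> carrier (automaton_group Q)"
      by (intro funpow_in_generated_group [OF homeo_image_Bij]
          comp_in_generated_group [OF homeo_image_Bij] restrict_act_in_automaton_group)
    have "(?c ^^ k) x \<in> binary_sequences"
      using x by (induction k) (auto simp: act_binary)
    then have "(?c ^^ k) x \<in> U"
      using k n agree_sym by (auto simp: mem_cylinder)
    moreover have "(?c ^^ k) x \<in> orbit (automaton_group Q) (\<lambda>g. g) x"
      unfolding orbit_def using mem x by (intro CollectI exI [of _ "restrict (?c ^^ k) binary_sequences"]) auto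
    ultimately show "\<exists>z. z \<in> orbit (automaton_group Q) (\<lambda>g. g) x \<and> z \<in> U"
      by blast
  qed (simp add: y)
qed

text \<open>The inclusion of the whole space as the cylinder of \<open>n\<close> leading ones.\<close>

definition ones_then :: "nat \<Rightarrow> point \<Rightarrow> point" where
  "ones_then n z = (\<lambda>i. if i < n then 1 else z (i - n))"

lemma ones_then_0 [simp]: "ones_then 0 z = z"
  by (simp add: ones_then_def)

lemma ones_then_Suc [simp]: "ones_then (Suc n) z = 1 ## ones_then n z"
  by (auto simp: ones_then_def fun_eq_iff split: nat.split)

lemma ones_then_binary [simp]: "ones_then n z \<in> binary_sequences \<longleftrightarrow> z \<in> binary_sequences"
  by (induction n) auto

lemma ones_then_eq_iff [simp]: "ones_then n z = ones_then n z' \<longleftrightarrow> z = z'"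
  by (induction n) auto

lemma agree_ones_then [simp]: "agree (n + m) (ones_then n z) (ones_then n z') \<longleftrightarrow> agree m z z'"
  by (induction n) auto

lemma in_cylinder_ones_then:
  assumes "y \<in> cylinder (n + m) (ones_then n z)"
  obtains w where "y = ones_then n w" "w \<in> cylinder m z"
proof
  have "y i = 1" if "i < n" for i
  proof -
    have "ones_then n z i = y i"
      using assms that by (simp add: mem_cylinder agree_def)
    then show ?thesis
      using that by (simp add: ones_then_def)
  qed
  then show y: "y = ones_then n (\<lambda>i. y (i + n))"
    by (simp add: ones_then_def fun_eq_iff)
  have "y \<in> binary_sequences"
    using assms by (simp add: mem_cylinder)
  moreover have "agree (n + m) (ones_then n z) (ones_then n (\<lambda>i. y (i + n)))"
    using assms y by (simp add: mem_cylinder)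
  ultimately show "(\<lambda>i. y (i + n)) \<in> cylinder m z"
    by (simp add: mem_cylinder binary_sequences_def)
qed

text \<open>Since \<open>a\<^sup>2\<close> acts on the cylinder of \<open>11\<close> by \<open>a\<close>, the iterated squares of \<open>a\<close> reproduce \<open>a\<close> at
  arbitrarily small scale.\<close>

lemma Bas_a_power_ones_then:
  "(act Bas_a ^^ (2 ^ n)) (ones_then (2 * n) z) = ones_then (2 * n) (act Bas_a z)"
proof (induction n arbitrary: z)
  case (Suc n)
  have "act Bas_a (act Bas_a (1 ## 1 ## w)) = 1 ## 1 ## act Bas_a w" for w
    by (simp add: act_cons act_Unit output_digit_def flipping_def)
  then have "(act Bas_a ^^ (2 * m)) (1 ## 1 ## w) = 1 ## 1 ## (act Bas_a ^^ m) w" for m w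
    by (induction m) simp_all
  then show ?case
    using Suc.IH by simp
qed simp

text \<open>On the cylinder \<open>U\<close> of \<open>2n\<close> ones, the power \<open>a ^ 2^n\<close> is the identity exactly where the next
  digit is \<open>0\<close>. Comparing it with the trivial element violates quasi-analyticity at that scale.\<close>

lemma not_locally_quasi_analytic_automaton_group:
  assumes a: "Bas_a \<in> Q" and D: "compatible_metric binary_space D"
  shows "\<not> locally_quasi_analytic binary_space D (automaton_group Q) (\<lambda>g. g)"
proof
  assume "locally_quasi_analytic binary_space D (automaton_group Q) (\<lambda>g. g)"
  then obtain \<epsilon> where \<epsilon>: "\<epsilon> > 0" and lqa:
    "\<forall>U. openin binary_space U \<and> mdiam D U < \<epsilon> \<longrightarrow>
       (\<forall>g\<in>carrier (automaton_group Q). \<forall>h\<in>carrier (automaton_group Q).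
          \<forall>V. openin binary_space V \<and> V \<noteq> {} \<and> V \<subseteq> U \<longrightarrow>
            (\<forall>x\<in>V. g x = h x) \<longrightarrow> (\<forall>x\<in>U. g x = h x))"
    unfolding locally_quasi_analytic_def by (elim exE conjE)
  obtain n where n:
    "\<forall>x\<in>binary_sequences. \<forall>y\<in>binary_sequences. agree n x y \<longrightarrow> D x y < \<epsilon> / 2"
    using cylinders_uniformly_small [OF D half_gt_zero [OF \<epsilon>]] by (rule exE)
  define U where "U = cylinder (2 * n) (ones_then (2 * n) (\<lambda>_. 0))"
  define V where "V = cylinder (2 * n + 1) (ones_then (2 * n) (\<lambda>_. 0))"
  define g where "g = restrict (act Bas_a ^^ (2 ^ n)) binary_sequences"
  define h where "h = restrict id binary_sequences"
  define u where "u = ones_then (2 * n) (1 ## (\<lambda>_. 0))"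
  have zero: "(\<lambda>_. 0) \<in> binary_sequences"
    by (simp add: binary_sequences_def)
  have small: "mdiam D U < \<epsilon>"
  proof -
    have "(case p of (x, y) \<Rightarrow> D x y) \<le> \<epsilon> / 2" if "p \<in> U \<times> U" for p
    proof -
      obtain x y where p: "p = (x, y)"
        by (cases p)
      have xy: "x \<in> cylinder (2 * n) (ones_then (2 * n) (\<lambda>_. 0))"
        "y \<in> cylinder (2 * n) (ones_then (2 * n) (\<lambda>_. 0))"
        using that by (simp_all add: p U_def)
      then have "agree (2 * n) x y"
        unfolding mem_cylinder by (blast intro: agree_sym agree_trans)
      then have "agree n x y"
        by (rule agree_mono) simp
      then show ?thesis
        using n xy by (simp add: p mem_cylinder less_imp_le)
    qed
    then have "(SUP (x, y)\<in>U \<times> U. D x y) \<le> \<epsilon> / 2" if "U \<noteq> {}"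
      using that by (intro cSUP_least) simp_all
    then show ?thesis
      using \<epsilon> by (cases "U = {}") (auto simp: mdiam_def)
  qed
  have g: "g \<in> carrier (automaton_group Q)"
    unfolding g_def
    by (intro funpow_in_generated_group [OF homeo_image_Bij] restrict_act_in_automaton_group a)
  have h: "h \<in> carrier (automaton_group Q)"
    unfolding h_def by (rule id_in_generated_group [OF homeo_image_Bij])
  have V: "openin binary_space V" "V \<noteq> {}" "V \<subseteq> U"
  proof -
    have "ones_then (2 * n) (\<lambda>_. 0) \<in> V"
      using zero by (simp add: V_def mem_cylinder)
    then show "V \<noteq> {}"
      by blast
    show "V \<subseteq> U"
      unfolding U_def V_def cylinder_def using agree_mono [of "2 * n + 1" _ _ "2 * n"] by auto
  qed (simp add: V_def)
  have u: "u \<in> U"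
    using zero by (simp add: u_def U_def mem_cylinder) (simp add: agree_def ones_then_def)
  have "\<forall>x\<in>V. g x = h x"
  proof
    fix x assume x: "x \<in> V"
    then obtain w where w: "x = ones_then (2 * n) w" "w \<in> cylinder 1 (\<lambda>_. 0)"
      unfolding V_def by (rule in_cylinder_ones_then)
    have "w \<in> binary_sequences" "w 0 = 0"
      using w(2) by (simp_all add: mem_cylinder agree_def)
    then obtain w' where "w = 0 ## w'"
      by (metis binary_cases nat.case(1))
    then have "act Bas_a w = w"
      by (simp add: act_cons act_Unit output_digit_def flipping_def)
    then show "g x = h x"
      using w(1) \<open>w \<in> binary_sequences\<close> by (simp add: g_def h_def Bas_a_power_ones_then)
  qed
  moreover have "openin binary_space U"
    by (simp add: U_def)
  ultimately have "g u = h u"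
    using spec [OF lqa, of U, THEN mp, OF conjI [OF _ small], THEN bspec, OF _ g, THEN bspec, OF _ h,
        THEN spec, of V] V u by blast
  then have "act Bas_a (1 ## (\<lambda>_. 0)) = 1 ## (\<lambda>_. 0)"
    using zero by (simp add: g_def h_def u_def Bas_a_power_ones_then)
  then have "act Bas_b (\<lambda>_. 0) 0 = 0"
    by (simp add: act_cons)
  then show False
    by (simp add: output_digit_def flipping_def)
qed

proposition non_LQA_automaton_group:
  assumes "finite Q" "{Bas_a, Bas_b} \<subseteq> Q"
  shows "non_LQA_action binary_space (automaton_group Q) (\<lambda>g. g)"
  unfolding non_LQA_action_def
  using assms cantor_binary_space
    finitely_generated_generated_group [OF homeo_image_Bij] action_by_homeos_automaton_group
    minimal_automaton_group equicontinuous_automaton_group not_locally_quasi_analytic_automaton_group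
  by simp

section \<open>Fixed points in the Basilica group\<close>

definition nucleus :: "state set" where
  "nucleus = {Unit, Bas_a, Bas_a_inv, Bas_b, Bas_b_inv, Bas_b_a_inv, Bas_a_b_inv}"

text \<open>Maps that act on the digits after a sufficiently long prefix by elements of the nucleus. A
  derivation is the finite binary tree of prefixes, with leaves where the nucleus is reached.\<close>

inductive contracted :: "(point \<Rightarrow> point) \<Rightarrow> bool" where
  nucleus: "\<lbrakk>q \<in> nucleus; \<And>x. x \<in> binary_sequences \<Longrightarrow> f x = act q x\<rbrakk> \<Longrightarrow> contracted f"
| branch: "\<lbrakk>contracted f0; contracted f1;
      \<And>x. x \<in> binary_sequences \<Longrightarrow> f (0 ## x) = i0 ## f0 x;
      \<And>x. x \<in> binary_sequences \<Longrightarrow> f (1 ## x) = i1 ## f1 x\<rbrakk> \<Longrightarrow> contracted f"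

lemma contracted_cong:
  assumes "contracted f" "\<And>x. x \<in> binary_sequences \<Longrightarrow> f' x = f x"
  shows "contracted f'"
  using assms(1)
proof cases
  case (nucleus q)
  then show ?thesis
    using assms(2) contracted.nucleus by simp
next
  case (branch f0 f1 i0 i1)
  then show ?thesis
    using assms(2) by (intro contracted.branch [of f0 f1 f' i0 i1]) simp_all
qed

lemma contracted_fusible: "(s, q, r) \<in> fusible \<Longrightarrow> r \<in> nucleus \<Longrightarrow> contracted (act s \<circ> act q)"
  by (rule contracted.nucleus [of r]) (simp_all add: act_fusible)

lemma contracted_product_branch:
  assumes "contracted (act (residual s (output_digit q 0)) \<circ> act (residual q 0))"
    and "contracted (act (residual s (output_digit q 1)) \<circ> act (residual q 1))"
  shows "contracted (act s \<circ> act q)"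
  by (rule contracted.branch [OF assms]) (simp_all add: act_cons)

text \<open>The finite computation behind contraction. A product of a generator with an element of the
  nucleus either equals an element of the nucleus or splits into residual products of the same
  kind. The order of the steps resolves these dependencies: products whose residuals all lie in
  the nucleus come first, then those with a residual among them.\<close>

lemma contracted_generator_nucleus:
  assumes s: "s \<in> {Unit, Bas_a, Bas_a_inv, Bas_b, Bas_b_inv}" and q: "q \<in> nucleus"
  shows "contracted (act s \<circ> act q)"
proof -
  have base: "contracted (act Unit \<circ> act q)" "contracted (act q \<circ> act Unit)" if "q \<in> nucleus" for q
    by (rule contracted_fusible [of _ _ q]; simp add: fusible_def that)+
  have fused:
    "contracted (act Bas_a \<circ> act Bas_a_inv)" "contracted (act Bas_a_inv \<circ> act Bas_a)"
    "contracted (act Bas_b \<circ> act Bas_b_inv)" "contracted (act Bas_b_inv \<circ> act Bas_b)"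
    "contracted (act Bas_b \<circ> act Bas_a_inv)" "contracted (act Bas_a \<circ> act Bas_b_inv)"
    "contracted (act Bas_b_inv \<circ> act Bas_b_a_inv)" "contracted (act Bas_a_inv \<circ> act Bas_a_b_inv)"
    \<comment> \<open>Each product is one of these five states.\<close>
    by (rule contracted_fusible [of _ _ Unit] contracted_fusible [of _ _ Bas_b_a_inv]
          contracted_fusible [of _ _ Bas_a_b_inv] contracted_fusible [of _ _ Bas_a_inv]
          contracted_fusible [of _ _ Bas_b_inv];
        simp add: fusible_def nucleus_def; fail)+
  note simps = output_digit_def flipping_def base nucleus_def
  have bb: "contracted (act Bas_b \<circ> act Bas_b)"
    by (rule contracted_product_branch; simp add: simps)
  have BB: "contracted (act Bas_b_inv \<circ> act Bas_b_inv)"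
    by (rule contracted_product_branch; simp add: simps)
  have ab: "contracted (act Bas_a \<circ> act Bas_b)"
    by (rule contracted_product_branch; simp add: simps)
  have Ab: "contracted (act Bas_a_inv \<circ> act Bas_b)"
    by (rule contracted_product_branch; simp add: simps)
  have Ba: "contracted (act Bas_b_inv \<circ> act Bas_a)"
    by (rule contracted_product_branch; simp add: simps)
  have BA: "contracted (act Bas_b_inv \<circ> act Bas_a_inv)"
    by (rule contracted_product_branch; simp add: simps)
  have a_ba: "contracted (act Bas_a \<circ> act Bas_b_a_inv)"
    by (rule contracted_product_branch; simp add: simps)
  have A_ba: "contracted (act Bas_a_inv \<circ> act Bas_b_a_inv)"
    by (rule contracted_product_branch; simp add: simps)
  have b_ba: "contracted (act Bas_b \<circ> act Bas_b_a_inv)"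
    by (rule contracted_product_branch; simp add: simps)
  have B_ab: "contracted (act Bas_b_inv \<circ> act Bas_a_b_inv)"
    by (rule contracted_product_branch; simp add: simps)
  note short = bb BB ab Ab Ba BA a_ba A_ba b_ba B_ab
  have aa: "contracted (act Bas_a \<circ> act Bas_a)"
    by (rule contracted_product_branch; simp add: simps short)
  have AA: "contracted (act Bas_a_inv \<circ> act Bas_a_inv)"
    by (rule contracted_product_branch; simp add: simps short)
  have ba: "contracted (act Bas_b \<circ> act Bas_a)"
    by (rule contracted_product_branch; simp add: simps short)
  have AB: "contracted (act Bas_a_inv \<circ> act Bas_b_inv)"
    by (rule contracted_product_branch; simp add: simps short)
  have a_ab: "contracted (act Bas_a \<circ> act Bas_a_b_inv)"
    by (rule contracted_product_branch; simp add: simps short)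
  have b_ab: "contracted (act Bas_b \<circ> act Bas_a_b_inv)"
    by (rule contracted_product_branch; simp add: simps short)
  note long = aa AA ba AB a_ab b_ab
  show ?thesis
    using s q unfolding nucleus_def insert_iff empty_iff
    by (elim disjE FalseE) (simp_all add: base [unfolded nucleus_def] fused short long)
qed

lemma contracted_generator_comp:
  assumes "contracted f" "s \<in> {Unit, Bas_a, Bas_a_inv, Bas_b, Bas_b_inv}"
    and "f \<in> binary_sequences \<rightarrow> binary_sequences"
  shows "contracted (act s \<circ> f)"
  using assms
proof (induction arbitrary: s rule: contracted.induct)
  case (nucleus q f)
  show ?case
    by (rule contracted_cong [OF contracted_generator_nucleus [OF nucleus.prems(1) nucleus.hyps(1)]])
       (simp add: nucleus.hyps(2))
next
  case (branch f0 f1 f i0 i1)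
  have closed: "residual s i \<in> {Unit, Bas_a, Bas_a_inv, Bas_b, Bas_b_inv}" for i
    using branch.prems(1) by (cases "i = 0") auto
  have maps: "f (i ## x) \<in> binary_sequences"
    if "x \<in> binary_sequences" "i = 0 \<or> i = 1" for i x
    using branch.prems(2) that by (auto simp: Pi_iff)
  have "f0 \<in> binary_sequences \<rightarrow> binary_sequences" "f1 \<in> binary_sequences \<rightarrow> binary_sequences"
    using maps [of _ 0] maps [of _ 1] branch.hyps by (auto simp: Pi_iff)
  then have "contracted (act (residual s i0) \<circ> f0)" "contracted (act (residual s i1) \<circ> f1)"
    using branch.IH closed by blast+
  then show ?case
    by (rule contracted.branch) (simp_all add: branch.hyps act_cons)
qed

lemma contracted_Basilica_group:
  assumes "g \<in> carrier (automaton_group {Bas_a, Bas_b})"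
  shows "contracted g"
  using assms
proof (rule automaton_group_induct)
  show "contracted id"
    by (rule contracted.nucleus [of Unit]) (simp_all add: nucleus_def act_Unit)
next
  fix q f
  assume "q \<in> {Bas_a, Bas_b} \<union> inverse_state ` {Bas_a, Bas_b}" "contracted f"
    "f \<in> binary_sequences \<rightarrow> binary_sequences"
  then show "contracted (act q \<circ> f)"
    by (intro contracted_generator_comp) auto
qed (rule contracted_cong)

text \<open>Whether the set of fixed points is open can be decided after any prefix, so only the nucleus
  matters. A nontrivial state of the nucleus that has a fixed point is \<open>a\<close> or \<open>a\<inverse>\<close>; its fixed points
  start with \<open>0\<close>, and there its residual is trivial.\<close>

lemma contracted_fixed_points_open:
  assumes "contracted f" "x \<in> binary_sequences" "f x = x"
  shows "\<exists>n. \<forall>y\<in>cylinder n x. f y = y"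
  using assms
proof (induction arbitrary: x rule: contracted.induct)
  case (nucleus q f)
  have fixed: "act q x = x"
    using nucleus by simp
  obtain i x' where x: "x = i ## x'" "i = 0 \<or> i = 1" "x' \<in> binary_sequences"
    using nucleus.prems(1) binary_cases by blast
  have no_flip: "\<not> flipping q'" if "act q' z = z" "z \<in> binary_sequences" for q' z
  proof
    assume "flipping q'"
    then have "1 - z 0 = z 0"
      using fun_cong [OF that(1), of 0] by (simp add: output_digit_def)
    then show False
      by presburger
  qed
  have "act (residual q i) x' = x'"
    using fixed x by (simp add: act_cons)
  then have res: "\<not> flipping (residual q i)" "\<not> flipping q"
    using no_flip fixed x(3) nucleus.prems(1) by blast+
  have res_Unit: "residual q i = Unit"
    using nucleus.hyps(1) res by (auto simp: nucleus_def flipping_def split: if_splits)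
  have "f y = y" if y: "y \<in> cylinder 1 x" for y
  proof -
    obtain y' where "y = i ## y'" "y' \<in> cylinder 0 x'"
      using y unfolding x(1) One_nat_def by (rule in_cylinder_cons)
    then have "act q y = y"
      using res by (simp add: act_cons res_Unit act_Unit output_digit_def)
    then show ?thesis
      using y nucleus.hyps(2) by (simp add: mem_cylinder)
  qed
  then show ?case
    by blast
next
  case (branch f0 f1 f i0 i1)
  have "\<exists>n. \<forall>y\<in>cylinder n (i ## x'). f y = y"
    if fi: "\<And>x. x \<in> binary_sequences \<Longrightarrow> f (i ## x) = j ## h x"
      and ih: "\<And>x. \<lbrakk>x \<in> binary_sequences; h x = x\<rbrakk> \<Longrightarrow> \<exists>n. \<forall>y\<in>cylinder n x. h y = y"
      and x': "x' \<in> binary_sequences" "f (i ## x') = i ## x'" for i j h x'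
  proof -
    have j: "j = i" and "h x' = x'"
      using fi x' by auto
    then obtain n where n: "\<forall>y\<in>cylinder n x'. h y = y"
      using ih x' by blast
    have "f y = y" if y: "y \<in> cylinder (Suc n) (i ## x')" for y
    proof -
      obtain y' where "y = i ## y'" "y' \<in> cylinder n x'"
        using y by (rule in_cylinder_cons)
      then show ?thesis
        using fi n j by (simp add: mem_cylinder)
    qed
    then show ?thesis
      by blast
  qed
  moreover obtain i x' where "x = i ## x'" "i = 0 \<or> i = 1" "x' \<in> binary_sequences"
    using branch.prems(1) binary_cases by blast
  ultimately show ?case
    using branch by blast
qed

proposition Basilica_group_no_non_Hausdorff:
  assumes "g \<in> carrier (automaton_group {Bas_a, Bas_b})"
  shows "\<not> non_Hausdorff_element binary_space (\<lambda>g. g) g"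
proof
  assume "non_Hausdorff_element binary_space (\<lambda>g. g) g"
  then obtain x where x: "x \<in> binary_sequences" "g x = x"
    and nontrivial: "\<And>W. openin binary_space W \<Longrightarrow> x \<in> W \<Longrightarrow> \<exists>y\<in>W. g y \<noteq> y"
    unfolding non_Hausdorff_element_def by auto
  obtain n where "\<forall>y\<in>cylinder n x. g y = y"
    using contracted_fixed_points_open [OF contracted_Basilica_group [OF assms] x] by blast
  then show False
    using nontrivial [of "cylinder n x"] x by (auto simp: mem_cylinder)
qed

section \<open>A non-Hausdorff element\<close>

text \<open>Because of this commutation, the behaviour of \<open>d\<close> on \<open>0w\<close> (trivial) and on \<open>10w\<close> (nontrivial)
  recurs in every neighbourhood of the constant sequence \<open>1\<close>.\<close>

lemma Germ_ones_then: "act Germ (ones_then (2 * n) z) = ones_then (2 * n) (act Germ z)"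
  by (induction n) (simp_all add: act_cons output_digit_def flipping_def)

proposition Germ_non_Hausdorff: "non_Hausdorff_element binary_space (\<lambda>g. g) (homeo Germ)"
proof -
  define ones :: point where "ones = (\<lambda>_. 1)"
  have ones: "ones \<in> binary_sequences" "ones_then n ones = ones" for n
    by (simp_all add: ones_def binary_sequences_def ones_then_def fun_eq_iff)
  have zero: "(\<lambda>_. 0) \<in> binary_sequences"
    by (simp add: binary_sequences_def)
  have near: "cylinder (2 * n + m) (ones_then (2 * n) z) \<subseteq> W" if "cylinder n ones \<subseteq> W" for n m z W
  proof
    fix y assume "y \<in> cylinder (2 * n + m) (ones_then (2 * n) z)"
    then have y: "y \<in> binary_sequences" "agree (2 * n + m) (ones_then (2 * n) z) y"
      by (simp_all add: mem_cylinder)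
    then have "agree n (ones_then (2 * n) z) y"
      using agree_mono by simp
    then have "y \<in> cylinder n ones"
      using y(1) by (simp add: mem_cylinder agree_def ones_def ones_then_def)
    then show "y \<in> W"
      using that by (rule subsetD [rotated])
  qed
  show ?thesis
    unfolding non_Hausdorff_element_def
  proof (intro bexI conjI allI impI)
    \<comment> \<open>The fixed point starts with arbitrarily many ones, and these are preserved.\<close>
    have "act Germ ones i = ones i" for i
    proof -
      have "act Germ ones i = ones_then (2 * Suc i) (act Germ ones) i"
        using Germ_ones_then [of "Suc i" ones] ones(2) by metis
      also have "\<dots> = ones i"
        by (simp only: ones_then_def ones_def) simp
      finally show ?thesis .
    qed
    then show "homeo Germ ones = ones"
      using ones(1) by (simp add: homeo_def fun_eq_iff)
  next
    fix W assume "openin binary_space W \<and> ones \<in> W"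
    then obtain n where n: "cylinder n ones \<subseteq> W"
      unfolding openin_binary_space_iff by blast
    let ?y = "ones_then (2 * n) (1 ## 0 ## (\<lambda>_. 0))"
    have yb: "?y \<in> binary_sequences"
      using zero by simp
    then have "?y \<in> W"
      using near [OF n, of 0 "1 ## 0 ## (\<lambda>_. 0)"] by (auto simp: mem_cylinder)
    moreover have "homeo Germ ?y \<noteq> ?y"
    proof
      assume "homeo Germ ?y = ?y"
      then have "act Flip (\<lambda>_. 0) = (\<lambda>_. 0)"
        using yb by (simp add: homeo_def Germ_ones_then act_cons)
      then have "act Flip (\<lambda>_. 0) 0 = 0"
        by simp
      then show False
        by (simp add: output_digit_def flipping_def)
    qed
    ultimately show "\<not> (\<forall>y\<in>W. homeo Germ y = y)"
      by blast
  next
    fix W assume "openin binary_space W \<and> ones \<in> W"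
    then obtain n where n: "cylinder n ones \<subseteq> W"
      unfolding openin_binary_space_iff by blast
    let ?V = "cylinder (2 * n + 1) (ones_then (2 * n) (\<lambda>_. 0))"
    have "homeo Germ y = y" if y: "y \<in> ?V" for y
    proof -
      obtain w where w: "y = ones_then (2 * n) w" "w \<in> cylinder 1 (\<lambda>_. 0)"
        using y by (rule in_cylinder_ones_then)
      have "w \<in> binary_sequences" "w 0 = 0"
        using w(2) by (simp_all add: mem_cylinder agree_def)
      then obtain w' where "w = 0 ## w'"
        by (metis binary_cases nat.case(1))
      then have "act Germ w = w"
        by (simp add: act_cons act_Unit output_digit_def flipping_def)
      then show ?thesis
        using w by (simp add: homeo_def Germ_ones_then mem_cylinder)
    qed
    moreover have "ones_then (2 * n) (\<lambda>_. 0) \<in> ?V"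
      using zero by (simp add: mem_cylinder)
    ultimately show "\<exists>V. openin binary_space V \<and> V \<noteq> {} \<and> V \<subseteq> W \<and> (\<forall>y\<in>V. homeo Germ y = y)"
      using near [OF n] by (intro exI [of _ ?V] conjI ballI openin_cylinder) blast+
  qed (simp add: ones)
qed

section \<open>The two classes\<close>

theorem corollary1p6:
  shows "(\<exists>(X :: point topology) (G :: group_elem monoid) (\<Phi> :: group_elem \<Rightarrow> point \<Rightarrow> point).
            cantor_space X \<and> finitely_generated_group G \<and> action_by_homeos X G \<Phi> \<and>
            minimal_action X G \<Phi> \<and>
            (\<forall>D. compatible_metric X D \<longrightarrow>
               equicontinuous_action X D G \<Phi> \<and> \<not> locally_quasi_analytic X D G \<Phi>) \<and>
            \<not> (\<exists>g \<in> carrier G. non_Hausdorff_element X \<Phi> g))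
       \<and> (let A = (non_LQA_with_non_Hausdorff ::
                     (point topology \<times> group_elem monoid \<times> (group_elem \<Rightarrow> point \<Rightarrow> point)) set);
              B = (non_LQA_without_non_Hausdorff ::
                     (point topology \<times> group_elem monoid \<times> (group_elem \<Rightarrow> point \<Rightarrow> point)) set)
          in A \<noteq> {} \<and> B \<noteq> {} \<and> A \<noteq> B \<and> A \<inter> B = {})"
proof -
  have "non_LQA_action binary_space (automaton_group {Bas_a, Bas_b}) (\<lambda>g. g)"
    by (rule non_LQA_automaton_group) auto
  moreover have "\<not> (\<exists>g\<in>carrier (automaton_group {Bas_a, Bas_b}).
      non_Hausdorff_element binary_space (\<lambda>g. g) g)"
    using Basilica_group_no_non_Hausdorff by blast
  ultimately have without:
    "(binary_space, automaton_group {Bas_a, Bas_b}, \<lambda>g. g) \<in> non_LQA_without_non_Hausdorff"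
    unfolding non_LQA_without_non_Hausdorff_def by blast
  have "non_LQA_action binary_space (automaton_group {Bas_a, Bas_b, Germ}) (\<lambda>g. g)"
    by (rule non_LQA_automaton_group) auto
  moreover have "homeo Germ \<in> carrier (automaton_group {Bas_a, Bas_b, Germ})"
    by (rule homeo_in_automaton_group) simp
  ultimately have with_nH:
    "(binary_space, automaton_group {Bas_a, Bas_b, Germ}, \<lambda>g. g) \<in> non_LQA_with_non_Hausdorff"
    unfolding non_LQA_with_non_Hausdorff_def using Germ_non_Hausdorff by blast
  have disjoint: "non_LQA_with_non_Hausdorff \<inter> non_LQA_without_non_Hausdorff = {}"
    unfolding non_LQA_with_non_Hausdorff_def non_LQA_without_non_Hausdorff_def by blast
  show ?thesis
  proof (rule conjI)
    show "\<exists>(X :: point topology) (G :: group_elem monoid) (\<Phi> :: group_elem \<Rightarrow> point \<Rightarrow> point).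
            cantor_space X \<and> finitely_generated_group G \<and> action_by_homeos X G \<Phi> \<and>
            minimal_action X G \<Phi> \<and>
            (\<forall>D. compatible_metric X D \<longrightarrow>
               equicontinuous_action X D G \<Phi> \<and> \<not> locally_quasi_analytic X D G \<Phi>) \<and>
            \<not> (\<exists>g \<in> carrier G. non_Hausdorff_element X \<Phi> g)"
      using without unfolding non_LQA_without_non_Hausdorff_def non_LQA_action_def by blast
    show "let A = (non_LQA_with_non_Hausdorff ::
                     (point topology \<times> group_elem monoid \<times> (group_elem \<Rightarrow> point \<Rightarrow> point)) set);
              B = (non_LQA_without_non_Hausdorff ::
                     (point topology \<times> group_elem monoid \<times> (group_elem \<Rightarrow> point \<Rightarrow> point)) set)
          in A \<noteq> {} \<and> B \<noteq> {} \<and> A \<noteq> B \<and> A \<inter> B = {}"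
      unfolding Let_def using without with_nH disjoint by blast
  qed
qed

end
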